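(* Let $\mathbb{D}$ be a division ring with finite dimension $d$ over a central subfield $\mathbb{F}$, and let $V$ be a right $\mathbb{D}$-vector space with finite dimension $n>0$. Assume that $\mathbb{D}$ is of quadratic type over $\mathbb{F}$, with associated pair $(\sigma,e)$. Let $B$ and $B'$ be $e$-nonisotropic $\sigma$-sesquilinear forms on $V$, and set $b:(x,y)\mapsto e(B(x,y))$ and $b':(x,y)\mapsto e(B'(x,y))$. Then $\mathcal{A}_{b,\mathbb{D}}$ is similar to $\mathcal{A}_{b',\mathbb{D}}$ in the algebra $\operatorname{End}_{\mathbb{D}}(V)$ if and only if $B'$ is equivalent to $\alpha B$ as a $\sigma$-sesquilinear form for some $\alpha\in\mathbb{F}^\times$.
   Context: A central subfield of $\mathbb{D}$ is a subfield contained in the center of $\mathbb{D}$. For an $\mathbb{F}$-bilinear form $b:V\times V\to\mathbb{F}$, $\mathcal{A}_{b,\mathbb{D}}$ is the set of all $\mathbb{D}$-linear endomorphisms $u$ of $V$ such that $b(x,u(x))=0$ for all $x\in V$. Two subsets $\mathcal{S},\mathcal{T}$ of an algebra $\mathcal{A}$ are similar if $\mathcal{T}=a\mathcal{S}a^{-1}$ for some unit $a$ of $\mathcal{A}$. $\mathbb{D}$ is of quadratic type over $\mathbb{F}$ if one of the following holds: (i) $d=1$; (ii) $d=2$ and $\mathbb{D}$ is a separable field extension of $\mathbb{F}$; (iii) $d=4$ and $\mathbb{D}$ is a quaternion algebra over $\mathbb{F}$; (iv) $d=2^m$ for some $m\geq 1$, $\operatorname{char}(\mathbb{F})=2$, $\mathbb{D}$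 is a field and $x^2\in\mathbb{F}$ for all $x\in\mathbb{D}$. The standard involution $\sigma$ of $\mathbb{D}$ is the identity of $\mathbb{D}$ in cases (i) and (iv), the non-identity $\mathbb{F}$-automorphism in case (ii), and the quaternionic conjugation in case (iii). An associated pair $(\sigma,e)$ for $\mathbb{D}$ over $\mathbb{F}$ consists of the standard involution $\sigma$ and of an $\mathbb{F}$-linear form $e:\mathbb{D}\to\mathbb{F}$ which is the Galois trace of $\mathbb{D}$ over $\mathbb{F}$ in cases (i) and (ii) (so $e=\operatorname{id}$ if $d=1$), the reduced trace $x\mapsto x+\sigma(x)$ in case (iii), and an arbitrary nonzero $\mathbb{F}$-linear form on $\mathbb{D}$ in case (iv). A $\sigma$-sesquilinear form on $V$ is a map $B:V^2\to\mathbb{D}$ such that $B(x\alpha+y,z)=\sigma(\alpha)B(x,z)+B(y,z)$ and $B(z,x\alpha+y)=B(z,x)\alpha+B(z,y)$ for all $\alpha\in\mathbb{D}$ and $x,y,z\in V$. It is $e$-nonisotropic if $e(B(x,x))\neq 0$ for all $x\in V\setminus\{0\}$. Two such forms $B,B'$ are equivalent if there is an automorphism $\varphi$ of the $\mathbb{D}$-vector space $V$ such that $B'(\varphi(x),\varphi(y))=B(x,y)$ for all $x,y\in V$. *)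

theory Defs
  imports Complex_Main "HOL-Computational_Algebra.Polynomial"
begin

section \<open>A division ring over a central subfield\<close>

text \<open>The central subfield is the image of an embedding \<open>\<iota>\<close> of the field \<open>'f\<close> into the center
  of \<open>'d\<close>; the injectivity of \<open>\<iota>\<close> follows from the axioms, as \<open>\<iota> 1 = 1\<close>.\<close>

locale central_subfield =
  fixes \<iota> :: "'f::field \<Rightarrow> 'd::division_ring"
  assumes embed_add: "\<iota> (a + b) = \<iota> a + \<iota> b"
    and embed_mult: "\<iota> (a * b) = \<iota> a * \<iota> b"
    and embed_one: "\<iota> 1 = 1"
    and embed_central: "\<iota> a * x = x * \<iota> a"

definition fscale :: "('f::field \<Rightarrow> 'd::division_ring) \<Rightarrow> 'f \<Rightarrow> 'd \<Rightarrow> 'd" where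
  "fscale \<iota> a x = \<iota> a * x"

definition has_degree :: "('f::field \<Rightarrow> 'd::division_ring) \<Rightarrow> nat \<Rightarrow> bool" where
  "has_degree \<iota> d \<longleftrightarrow>
     (\<exists>Basis. finite_dimensional_vector_space (fscale \<iota>) Basis) \<and>
     vector_space.dim (fscale \<iota>) UNIV = d"

definition commutative_ring :: "'d::division_ring itself \<Rightarrow> bool" where
  "commutative_ring _ \<longleftrightarrow> (\<forall>x y :: 'd. x * y = y * x)"

text \<open>The function \<open>poly\<close> is not available here, as \<open>'d\<close> need not be commutative.\<close>

definition eval_at :: "('f::field \<Rightarrow> 'd::division_ring) \<Rightarrow> 'f poly \<Rightarrow> 'd \<Rightarrow> 'd" where
  "eval_at \<iota> p x = (\<Sum>k\<le>degree p. \<iota> (coeff p k) * x ^ k)"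

definition minimal_polynomial ::
    "('f::field \<Rightarrow> 'd::division_ring) \<Rightarrow> 'd \<Rightarrow> 'f poly \<Rightarrow> bool" where
  "minimal_polynomial \<iota> x p \<longleftrightarrow>
     lead_coeff p = 1 \<and> eval_at \<iota> p x = 0 \<and>
     (\<forall>q. q \<noteq> 0 \<and> eval_at \<iota> q x = 0 \<longrightarrow> degree p \<le> degree q)"

definition separable_field_extension :: "('f::field \<Rightarrow> 'd::division_ring) \<Rightarrow> bool" where
  "separable_field_extension \<iota> \<longleftrightarrow>
     commutative_ring TYPE('d) \<and>
     (\<forall>x. \<exists>p. minimal_polynomial \<iota> x p \<and> coprime p (pderiv p))"

definition field_automorphism :: "('f::field \<Rightarrow> 'd::division_ring) \<Rightarrow> ('d \<Rightarrow> 'd) \<Rightarrow> bool" where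
  "field_automorphism \<iota> \<tau> \<longleftrightarrow>
     bij \<tau> \<and> (\<forall>x y. \<tau> (x + y) = \<tau> x + \<tau> y) \<and> (\<forall>x y. \<tau> (x * y) = \<tau> x * \<tau> y) \<and>
     (\<forall>a. \<tau> (\<iota> a) = \<iota> a)"

definition galois_trace :: "('f::field \<Rightarrow> 'd::division_ring) \<Rightarrow> ('d \<Rightarrow> 'f) \<Rightarrow> bool" where
  "galois_trace \<iota> e \<longleftrightarrow> (\<forall>x. \<iota> (e x) = (\<Sum>\<tau> | field_automorphism \<iota> \<tau>. \<tau> x))"

subsection \<open>Quaternion algebras\<close>

text \<open>Quaternion algebras of type \<open>(\<alpha>, \<beta>, \<gamma>)\<close>, in any characteristic, following Bourbaki:
  \<open>1, i, j, i * j\<close> is a basis, \<open>i\<^sup>2 = \<alpha> + \<beta> i\<close>, \<open>j\<^sup>2 = \<gamma>\<close> and \<open>j i = (\<beta> - i) j\<close>.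
  One may take \<open>\<beta> = 0\<close> if the characteristic is not \<open>2\<close> (whence \<open>i\<^sup>2 = \<alpha>\<close> and \<open>j i = - i j\<close>)
  and \<open>\<beta> = 1\<close> if it is \<open>2\<close>. The condition on \<open>\<beta>\<^sup>2 + 4 \<alpha>\<close> says that \<open>X\<^sup>2 - \<beta> X - \<alpha>\<close> is
  separable, and excludes the degenerate algebras.\<close>

definition quaternion_basis ::
    "('f::field \<Rightarrow> 'd::division_ring) \<Rightarrow> 'f \<Rightarrow> 'f \<Rightarrow> 'f \<Rightarrow> 'd \<Rightarrow> 'd \<Rightarrow> bool" where
  "quaternion_basis \<iota> \<alpha> \<beta> \<gamma> i j \<longleftrightarrow>
     \<beta>\<^sup>2 + 4 * \<alpha> \<noteq> 0 \<and> \<gamma> \<noteq> 0 \<and>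
     i * i = \<iota> \<alpha> + \<iota> \<beta> * i \<and> j * j = \<iota> \<gamma> \<and> j * i = (\<iota> \<beta> - i) * j \<and>
     (\<forall>x. \<exists>!(r, s, t, u). x = \<iota> r + \<iota> s * i + \<iota> t * j + \<iota> u * (i * j))"

definition quaternion_algebra :: "('f::field \<Rightarrow> 'd::division_ring) \<Rightarrow> bool" where
  "quaternion_algebra \<iota> \<longleftrightarrow> (\<exists>\<alpha> \<beta> \<gamma> i j. quaternion_basis \<iota> \<alpha> \<beta> \<gamma> i j)"

text \<open>The conjugation does not depend on the choice of the basis.\<close>

definition quaternionic_conjugation ::
    "('f::field \<Rightarrow> 'd::division_ring) \<Rightarrow> ('d \<Rightarrow> 'd) \<Rightarrow> bool" where
  "quaternionic_conjugation \<iota> \<sigma> \<longleftrightarrow>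
     (\<exists>\<alpha> \<beta> \<gamma> i j. quaternion_basis \<iota> \<alpha> \<beta> \<gamma> i j \<and>
        (\<forall>r s t u. \<sigma> (\<iota> r + \<iota> s * i + \<iota> t * j + \<iota> u * (i * j)) =
                   \<iota> r + \<iota> s * (\<iota> \<beta> - i) - \<iota> t * j - \<iota> u * (i * j)))"

subsection \<open>Quadratic type and associated pairs\<close>

definition quadratic_type1 :: "('f::field \<Rightarrow> 'd::division_ring) \<Rightarrow> bool" where
  "quadratic_type1 \<iota> \<longleftrightarrow> has_degree \<iota> 1"

definition quadratic_type2 :: "('f::field \<Rightarrow> 'd::division_ring) \<Rightarrow> bool" where
  "quadratic_type2 \<iota> \<longleftrightarrow> has_degree \<iota> 2 \<and> separable_field_extension \<iota>"

definition quadratic_type3 :: "('f::field \<Rightarrow> 'd::division_ring) \<Rightarrow> bool" where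
  "quadratic_type3 \<iota> \<longleftrightarrow> has_degree \<iota> 4 \<and> quaternion_algebra \<iota>"

definition quadratic_type4 :: "('f::field \<Rightarrow> 'd::division_ring) \<Rightarrow> bool" where
  "quadratic_type4 \<iota> \<longleftrightarrow>
     (\<exists>m\<ge>1. has_degree \<iota> (2 ^ m)) \<and> CHAR('f) = 2 \<and> commutative_ring TYPE('d) \<and>
     (\<forall>x. x\<^sup>2 \<in> range \<iota>)"

definition quadratic_type :: "('f::field \<Rightarrow> 'd::division_ring) \<Rightarrow> bool" where
  "quadratic_type \<iota> \<longleftrightarrow>
     quadratic_type1 \<iota> \<or> quadratic_type2 \<iota> \<or> quadratic_type3 \<iota> \<or> quadratic_type4 \<iota>"

text \<open>The four types exclude one another.\<close>

definition standard_involution ::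
    "('f::field \<Rightarrow> 'd::division_ring) \<Rightarrow> ('d \<Rightarrow> 'd) \<Rightarrow> bool" where
  "standard_involution \<iota> \<sigma> \<longleftrightarrow>
     (quadratic_type1 \<iota> \<or> quadratic_type4 \<iota> \<longrightarrow> \<sigma> = id) \<and>
     (quadratic_type2 \<iota> \<longrightarrow> field_automorphism \<iota> \<sigma> \<and> \<sigma> \<noteq> id) \<and>
     (quadratic_type3 \<iota> \<longrightarrow> quaternionic_conjugation \<iota> \<sigma>)"

definition associated_pair ::
    "('f::field \<Rightarrow> 'd::division_ring) \<Rightarrow> ('d \<Rightarrow> 'd) \<Rightarrow> ('d \<Rightarrow> 'f) \<Rightarrow> bool" where
  "associated_pair \<iota> \<sigma> e \<longleftrightarrow>
     standard_involution \<iota> \<sigma> \<and>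
     Vector_Spaces.linear (fscale \<iota>) (*) e \<and>
     (quadratic_type1 \<iota> \<or> quadratic_type2 \<iota> \<longrightarrow> galois_trace \<iota> e) \<and>
     (quadratic_type3 \<iota> \<longrightarrow> (\<forall>x. \<iota> (e x) = x + \<sigma> x)) \<and>
     (quadratic_type4 \<iota> \<longrightarrow> (\<exists>x. e x \<noteq> 0))"


section \<open>Right vector spaces over a division ring\<close>

locale right_vector_space =
  fixes rscale :: "'v::ab_group_add \<Rightarrow> 'd::division_ring \<Rightarrow> 'v" (infixl \<open>\<cdot>\<close> 75)
  assumes add_rscale: "(x + y) \<cdot> a = x \<cdot> a + y \<cdot> a"
    and rscale_add: "x \<cdot> (a + b) = x \<cdot> a + x \<cdot> b"
    and rscale_mult: "x \<cdot> (a * b) = (x \<cdot> a) \<cdot> b"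
    and rscale_one: "x \<cdot> 1 = x"

definition right_basis ::
    "('v::ab_group_add \<Rightarrow> 'd::division_ring \<Rightarrow> 'v) \<Rightarrow> 'v set \<Rightarrow> bool" where
  "right_basis rs S \<longleftrightarrow>
     finite S \<and>
     (\<forall>v. \<exists>c. v = (\<Sum>s\<in>S. rs s (c s))) \<and>
     (\<forall>c. (\<Sum>s\<in>S. rs s (c s)) = 0 \<longrightarrow> (\<forall>s\<in>S. c s = 0))"

definition has_right_dimension ::
    "('v::ab_group_add \<Rightarrow> 'd::division_ring \<Rightarrow> 'v) \<Rightarrow> nat \<Rightarrow> bool" where
  "has_right_dimension rs n \<longleftrightarrow> (\<exists>S. right_basis rs S \<and> card S = n)"

definition End_right ::
    "('v::ab_group_add \<Rightarrow> 'd::division_ring \<Rightarrow> 'v) \<Rightarrow> ('v \<Rightarrow> 'v) set" where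
  "End_right rs = {u. (\<forall>x y. u (x + y) = u x + u y) \<and> (\<forall>x a. u (rs x a) = rs (u x) a)}"

definition similar_in_End ::
    "('v::ab_group_add \<Rightarrow> 'd::division_ring \<Rightarrow> 'v) \<Rightarrow> ('v \<Rightarrow> 'v) set \<Rightarrow> ('v \<Rightarrow> 'v) set \<Rightarrow> bool" where
  "similar_in_End rs S T \<longleftrightarrow>
     (\<exists>a\<in>End_right rs. \<exists>a'\<in>End_right rs. a \<circ> a' = id \<and> a' \<circ> a = id \<and>
        T = (\<lambda>u. a \<circ> u \<circ> a') ` S)"

definition alternating_endos ::
    "('v::ab_group_add \<Rightarrow> 'd::division_ring \<Rightarrow> 'v) \<Rightarrow> ('v \<Rightarrow> 'v \<Rightarrow> 'f::field) \<Rightarrow> ('v \<Rightarrow> 'v) set" where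
  "alternating_endos rs b = {u \<in> End_right rs. \<forall>x. b x (u x) = 0}"

definition sesquilinear ::
    "('v::ab_group_add \<Rightarrow> 'd::division_ring \<Rightarrow> 'v) \<Rightarrow> ('d \<Rightarrow> 'd) \<Rightarrow> ('v \<Rightarrow> 'v \<Rightarrow> 'd) \<Rightarrow> bool" where
  "sesquilinear rs \<sigma> B \<longleftrightarrow>
     (\<forall>a x y z. B (rs x a + y) z = \<sigma> a * B x z + B y z) \<and>
     (\<forall>a x y z. B z (rs x a + y) = B z x * a + B z y)"

definition nonisotropic :: "('d \<Rightarrow> 'f::field) \<Rightarrow> ('v::ab_group_add \<Rightarrow> 'v \<Rightarrow> 'd) \<Rightarrow> bool" where
  "nonisotropic e B \<longleftrightarrow> (\<forall>x. x \<noteq> 0 \<longrightarrow> e (B x x) \<noteq> 0)"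

definition equivalent_forms ::
    "('v::ab_group_add \<Rightarrow> 'd::division_ring \<Rightarrow> 'v) \<Rightarrow>
     ('v \<Rightarrow> 'v \<Rightarrow> 'd) \<Rightarrow> ('v \<Rightarrow> 'v \<Rightarrow> 'd) \<Rightarrow> bool" where
  "equivalent_forms rs B B' \<longleftrightarrow>
     (\<exists>\<phi>\<in>End_right rs. bij \<phi> \<and> (\<forall>x y. B' (\<phi> x) (\<phi> y) = B x y))"

end

theory Submission
  imports Defs
begin

text \<open>If \<open>b (x, y) = 0\<close> and \<open>x \<noteq> 0\<close>, then some \<open>u\<close> in \<open>\<A>\<^sub>b\<close> maps \<open>x\<close> to \<open>y\<close>. Indeed
  \<open>\<A>\<^sub>b\<close> contains every endomorphism \<open>z \<mapsto> y \<sigma>(B(z, x)) - x \<sigma>(B(z, y))\<close>, because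
  \<open>e \<circ> \<sigma> = e\<close>; and it contains \<open>z \<mapsto> x s \<sigma>(B(z, x))\<close> as soon as \<open>e s = 0\<close>, because
  \<open>e (w s \<sigma>(w)) = N(w) e(s)\<close> for the norm \<open>N(w) = w \<sigma>(w)\<close>, which lies in the central subfield.
  Thus \<open>\<A>\<^sub>b\<close> determines the orthogonal hyperplane of each vector. If
  \<open>\<A>\<^sub>b\<close> is conjugated onto \<open>\<A>\<^sub>b\<^sub>'\<close> by \<open>a\<close>, the form \<open>b' (a x, a y)\<close> is therefore \<open>\<lambda> x * b (x, y)\<close>
  for some scalars \<open>\<lambda> x\<close>; they do not depend on \<open>x\<close>, and as \<open>e \<noteq> 0\<close> the proportionality lifts
  to \<open>B\<close> and \<open>B'\<close>.\<close>

section \<open>Norms and traces in the quadratic types\<close>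

context central_subfield
begin

lemma embed_zero [simp]: "\<iota> 0 = 0"
  using embed_add[of 0 0] by simp

lemma embed_minus: "\<iota> (- a) = - \<iota> a"
  using embed_add[of a "- a"] by (simp add: eq_neg_iff_add_eq_0 add.commute)

lemma embed_diff: "\<iota> (a - b) = \<iota> a - \<iota> b"
  using embed_add[of a "- b"] by (simp add: embed_minus)

lemma embed_eq_zero_iff [simp]: "\<iota> a = 0 \<longleftrightarrow> a = 0"
proof
  assume "\<iota> a = 0"
  then show "a = 0"
    using embed_mult[of a "inverse a"] embed_one by (cases "a = 0") auto
qed simp

lemma embed_eq_iff: "\<iota> a = \<iota> b \<longleftrightarrow> a = b"
  using embed_eq_zero_iff[of "a - b"] by (simp add: embed_diff)

lemma embed_left_commute: "x * (\<iota> a * y) = \<iota> a * (x * y)"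
  by (metis embed_central mult.assoc)

lemma embed_ac:
  "\<iota> a * \<iota> b = \<iota> b * \<iota> a" "\<iota> a * (\<iota> b * x) = \<iota> b * (\<iota> a * x)"
  by (rule embed_central, rule embed_left_commute)

lemma degree_one_surj:
  assumes "has_degree \<iota> 1"
  shows "x \<in> range \<iota>"
proof -
  obtain Basis where "finite_dimensional_vector_space (fscale \<iota>) Basis"
    and dim: "vector_space.dim (fscale \<iota>) UNIV = 1"
    using assms by (auto simp: has_degree_def)
  then interpret F: finite_dimensional_vector_space "fscale \<iota>" Basis by simp
  have "F.independent {1}" by simp
  then have "x \<in> F.span {1}"
    using F.card_ge_dim_independent[of "{1}" UNIV] dim by auto
  then show ?thesis by (auto simp: F.span_singleton fscale_def)
qed

lemma degree_two_span:
  assumes "has_degree \<iota> 2" and "x \<notin> range \<iota>"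
  obtains p q where "y = \<iota> p + \<iota> q * x"
proof -
  obtain Basis where "finite_dimensional_vector_space (fscale \<iota>) Basis"
    and dim: "vector_space.dim (fscale \<iota>) UNIV = 2"
    using assms by (auto simp: has_degree_def)
  then interpret F: finite_dimensional_vector_space "fscale \<iota>" Basis by simp
  have x: "x \<notin> F.span {1}" using assms(2) by (auto simp: F.span_singleton fscale_def)
  then have "x \<noteq> 1" using F.span_base by blast
  moreover have "F.independent {x, 1}" using x by (simp add: F.independent_insert)
  ultimately have "y \<in> F.span {x, 1}"
    using F.card_ge_dim_independent[of "{x, 1}" UNIV] dim by auto
  then obtain q where "y - fscale \<iota> q x \<in> F.span {1}" by (auto simp: F.span_insert)
  then obtain p where "y - \<iota> q * x = \<iota> p" by (auto simp: F.span_singleton fscale_def)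
  then have "y = \<iota> p + \<iota> q * x" by (simp add: algebra_simps)
  then show ?thesis by (rule that)
qed

end

locale norm_trace_pair = central_subfield \<iota>
  for \<iota> :: "'f::field \<Rightarrow> 'd::division_ring" +
  fixes \<sigma> :: "'d \<Rightarrow> 'd" and e :: "'d \<Rightarrow> 'f"
  assumes e_add: "e (x + y) = e x + e y"
    and e_scale: "e (\<iota> a * x) = a * e x"
    and inv_add: "\<sigma> (x + y) = \<sigma> x + \<sigma> y"
    and inv_mult: "\<sigma> (x * y) = \<sigma> y * \<sigma> x"
    and inv_inv [simp]: "\<sigma> (\<sigma> x) = x"
    and e_inv: "e (\<sigma> x) = e x"
    and norm: "\<exists>N. w * \<sigma> w = \<iota> N \<and> (\<forall>s. e (w * s * \<sigma> w) = N * e s)"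
begin

lemma e_zero [simp]: "e 0 = 0"
  using e_scale[of 0 0] by simp

lemma e_diff: "e (x - y) = e x - e y"
  using e_add[of "x - y" y] by simp

lemma inv_zero [simp]: "\<sigma> 0 = 0"
  using inv_add[of 0 0] by simp

lemma inv_eq_zero_iff [simp]: "\<sigma> x = 0 \<longleftrightarrow> x = 0"
  by (metis inv_inv inv_zero)

lemma e_norm_eq_zero_iff:
  assumes "w \<noteq> 0"
  shows "e (w * s * \<sigma> w) = 0 \<longleftrightarrow> e s = 0"
proof -
  obtain N where "w * \<sigma> w = \<iota> N" "e (w * s * \<sigma> w) = N * e s"
    using norm[of w] by auto
  then show ?thesis using assms by (metis embed_eq_zero_iff inv_eq_zero_iff mult_eq_0_iff)
qed

end

context central_subfield
begin

lemma linear_form_rules: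
  assumes "Vector_Spaces.linear (fscale \<iota>) (*) e"
  shows "e (x + y) = e x + e y" and "e (\<iota> a * x) = a * e x"
proof -
  interpret Vector_Spaces.linear "fscale \<iota>" "(*)" e by (fact assms)
  show "e (x + y) = e x + e y" by (fact add)
  show "e (\<iota> a * x) = a * e x" using scale[of a x] by (simp add: fscale_def)
qed

lemma norm_trace_pair_id:
  assumes comm: "\<And>x y :: 'd. x * y = y * x"
    and sq: "\<And>x :: 'd. x * x \<in> range \<iota>"
    and lin: "Vector_Spaces.linear (fscale \<iota>) (*) e"
  shows "norm_trace_pair \<iota> id e"
proof unfold_locales
  fix w :: 'd
  obtain N where N: "w * w = \<iota> N" using sq[of w] by auto
  have "e (w * s * w) = N * e s" for s
  proof -
    have "w * s * w = \<iota> N * s" by (metis N comm mult.assoc)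
    then show ?thesis by (simp add: linear_form_rules[OF lin])
  qed
  then show "\<exists>N. w * id w = \<iota> N \<and> (\<forall>s. e (w * s * id w) = N * e s)" using N by auto
qed (use comm linear_form_rules[OF lin] in auto)

lemma galois_trace_invariant:
  assumes tr: "galois_trace \<iota> e" and aut: "field_automorphism \<iota> \<sigma>"
    and invol: "\<And>x. \<sigma> (\<sigma> x) = x"
  shows "e (\<sigma> x) = e x"
proof -
  have comp: "field_automorphism \<iota> (\<tau> \<circ> \<sigma>)" if "field_automorphism \<iota> \<tau>" for \<tau>
    using that aut by (auto simp: field_automorphism_def intro: bij_comp)
  have "bij_betw (\<lambda>\<tau>. \<tau> \<circ> \<sigma>) {\<tau>. field_automorphism \<iota> \<tau>} {\<tau>. field_automorphism \<iota> \<tau>}"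
    by (rule bij_betw_byWitness[where f' = "\<lambda>\<tau>. \<tau> \<circ> \<sigma>"]) (auto simp: comp comp_assoc invol fun_eq_iff)
  from sum.reindex_bij_betw[OF this, of "\<lambda>\<tau>. \<tau> x"]
  have "\<iota> (e (\<sigma> x)) = \<iota> (e x)"
    using tr by (simp add: galois_trace_def)
  then show ?thesis by (simp add: embed_eq_iff)
qed

lemma norm_trace_pair_separable:
  assumes deg: "has_degree \<iota> 2" and comm: "\<And>x y :: 'd. x * y = y * x"
    and aut: "field_automorphism \<iota> \<sigma>" and "\<sigma> \<noteq> id"
    and tr: "galois_trace \<iota> e"
    and lin: "Vector_Spaces.linear (fscale \<iota>) (*) e"
  shows "norm_trace_pair \<iota> \<sigma> e"
proof -
  have aut_add: "\<sigma> (x + y) = \<sigma> x + \<sigma> y" and aut_mult: "\<sigma> (x * y) = \<sigma> x * \<sigma> y"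
    and aut_embed: "\<sigma> (\<iota> a) = \<iota> a" for x y a
    using aut by (auto simp: field_automorphism_def)
  obtain x where x: "\<sigma> x \<noteq> x" using \<open>\<sigma> \<noteq> id\<close> by (auto simp: fun_eq_iff)
  have x_notin: "x \<notin> range \<iota>" using x aut_embed by auto
  have left_comm: "x * (y * z) = y * (x * z)" for x y z :: 'd by (metis comm mult.assoc)
  note mult_ac = comm left_comm
  note span = degree_two_span[OF deg x_notin]
  obtain q p where pq: "x * x = \<iota> q + \<iota> p * x" by (rule span)
  txt \<open>Both \<open>x\<close> and \<open>\<sigma> x\<close> are roots of \<open>X\<^sup>2 - p X - q\<close>, whose roots sum to \<open>p\<close>.\<close>
  have "\<sigma> x * \<sigma> x = \<iota> q + \<iota> p * \<sigma> x" using pq by (metis aut_add aut_mult aut_embed)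
  then have "(\<sigma> x - x) * (\<sigma> x + x - \<iota> p) = 0"
    using pq by (simp add: algebra_simps mult_ac)
  then have "\<sigma> x + x - \<iota> p = 0" using x by (simp add: mult_eq_0_iff)
  then have conj: "\<sigma> x = \<iota> p - x" by (simp add: algebra_simps)
  have conj_gen: "\<sigma> (\<iota> r + \<iota> s * x) = \<iota> r + \<iota> s * (\<iota> p - x)" for r s
    by (simp add: aut_add aut_mult aut_embed conj)
  have invol: "\<sigma> (\<sigma> y) = y" for y
  proof -
    obtain r s where y: "y = \<iota> r + \<iota> s * x" by (rule span)
    have "\<sigma> y = \<iota> (r + s * p) + \<iota> (- s) * x"
      unfolding y conj_gen by (simp add: embed_add embed_mult embed_minus algebra_simps mult_ac)
    then have "\<sigma> (\<sigma> y) = \<iota> (r + s * p) + \<iota> (- s) * (\<iota> p - x)" by (simp only: conj_gen)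
    then show ?thesis
      by (simp add: y embed_add embed_mult embed_minus algebra_simps mult_ac)
  qed
  have norm: "\<exists>N. w * \<sigma> w = \<iota> N" for w
  proof -
    obtain r s where w: "w = \<iota> r + \<iota> s * x" by (rule span)
    have "w * \<sigma> w = \<iota> (r * r) + \<iota> (r * s * p) + \<iota> (s * s) * (\<iota> p * x - x * x)"
        unfolding w conj_gen
      by (simp add: embed_mult algebra_simps mult_ac)
    also have "\<dots> = \<iota> (r * r + r * s * p - s * s * q)"
      by (simp add: pq embed_add embed_mult embed_diff algebra_simps mult_ac)
    finally show ?thesis by blast
  qed
  show ?thesis
  proof unfold_locales
    fix w
    obtain N where N: "w * \<sigma> w = \<iota> N" using norm by blast
    have "e (w * s * \<sigma> w) = N * e s" for s
    proof -
      have "w * s * \<sigma> w = \<iota> N * s" by (metis N comm mult.assoc)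
      then show ?thesis by (simp add: linear_form_rules[OF lin])
    qed
    then show "\<exists>N. w * \<sigma> w = \<iota> N \<and> (\<forall>s. e (w * s * \<sigma> w) = N * e s)" using N by auto
  next
    show "\<sigma> (x * y) = \<sigma> y * \<sigma> x" for x y using aut_mult comm by simp
  qed (auto simp: linear_form_rules[OF lin] aut_add invol galois_trace_invariant[OF tr aut invol])
qed

definition quaternion :: "'d \<Rightarrow> 'd \<Rightarrow> 'f \<Rightarrow> 'f \<Rightarrow> 'f \<Rightarrow> 'f \<Rightarrow> 'd" where
  "quaternion i j r s t u = \<iota> r + \<iota> s * i + (\<iota> t + \<iota> u * i) * j"

lemma quadratic_mult:
  assumes "i * i = \<iota> \<alpha> + \<iota> \<beta> * i"
  shows "(\<iota> r + \<iota> s * i) * (\<iota> r' + \<iota> s' * i) =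
    \<iota> (r * r' + \<alpha> * s * s') + \<iota> (r * s' + s * r' + \<beta> * s * s') * i"
proof -
  have "(\<iota> r + \<iota> s * i) * (\<iota> r' + \<iota> s' * i) =
      \<iota> r * \<iota> r' + \<iota> r * \<iota> s' * i + \<iota> s * (i * \<iota> r') + \<iota> s * (i * (\<iota> s' * i))"
    by (simp add: algebra_simps)
  also have "\<dots> = \<iota> r * \<iota> r' + \<iota> r * \<iota> s' * i + \<iota> s * \<iota> r' * i + \<iota> s * \<iota> s' * (i * i)"
    by (simp add: embed_central[of _ i, symmetric] embed_left_commute[of i] mult.assoc)
  also have "\<dots> = \<iota> (r * r' + \<alpha> * s * s') + \<iota> (r * s' + s * r' + \<beta> * s * s') * i"
    by (simp add: assms embed_add embed_mult embed_ac algebra_simps)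
  finally show ?thesis .
qed

lemma quaternion_mult:
  assumes ii: "i * i = \<iota> \<alpha> + \<iota> \<beta> * i" and jj: "j * j = \<iota> \<gamma>" and ji: "j * i = (\<iota> \<beta> - i) * j"
  shows "quaternion i j r s t u * quaternion i j r' s' t' u' =
    quaternion i j
      (r * r' + \<alpha> * s * s' + \<gamma> * (t * (t' + \<beta> * u') - \<alpha> * u * u'))
      (r * s' + s * r' + \<beta> * s * s' + \<gamma> * (u * (t' + \<beta> * u') - t * u' - \<beta> * u * u'))
      (r * t' + \<alpha> * s * u' + t * (r' + \<beta> * s') - \<alpha> * u * s')
      (r * u' + s * t' + \<beta> * s * u' + u * (r' + \<beta> * s') - t * s' - \<beta> * u * s')"
proof -
  define k where "k = (\<lambda>r s. \<iota> r + \<iota> s * i)"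
  have q: "quaternion i j r s t u = k r s + k t u * j" for r s t u
    by (simp add: quaternion_def k_def)
  have km: "k r s * k r' s' = k (r * r' + \<alpha> * s * s') (r * s' + s * r' + \<beta> * s * s')" for r s r' s'
    unfolding k_def by (rule quadratic_mult[OF ii])
  have ka: "k r s + k r' s' = k (r + r') (s + s')" for r s r' s'
    by (simp add: k_def embed_add algebra_simps)
  have jk: "j * k r s = k (r + \<beta> * s) (- s) * j" for r s
  proof -
    have "j * k r s = \<iota> r * j + \<iota> s * (j * i)"
      by (simp add: k_def distrib_left embed_central[of r j] embed_left_commute[of j])
    also have "\<dots> = k (r + \<beta> * s) (- s) * j"
      by (simp add: ji k_def embed_add embed_mult embed_minus embed_ac algebra_simps)
    finally show ?thesis .
  qed
  have kg: "k r s * \<iota> \<gamma> = k (\<gamma> * r) (\<gamma> * s)" for r s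
    by (simp add: k_def embed_mult embed_central[of \<gamma>, symmetric] algebra_simps)
  have "(k r s + k t u * j) * (k r' s' + k t' u' * j) =
      k r s * k r' s' + k r s * k t' u' * j + k t u * (j * k r' s') + k t u * (j * k t' u') * j"
    by (simp add: algebra_simps)
  also have "\<dots> = k r s * k r' s' + k r s * k t' u' * j + k t u * k (r' + \<beta> * s') (- s') * j
      + k t u * k (t' + \<beta> * u') (- u') * \<iota> \<gamma>"
    by (simp add: jk jj[symmetric] mult.assoc)
  also have "\<dots> = (k r s * k r' s' + k t u * k (t' + \<beta> * u') (- u') * \<iota> \<gamma>)
      + (k r s * k t' u' + k t u * k (r' + \<beta> * s') (- s')) * j"
    by (simp add: algebra_simps)
  finally show ?thesis
    unfolding q km kg ka by (simp add: algebra_simps)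
qed

lemma norm_trace_pair_quaternion:
  assumes conj: "quaternionic_conjugation \<iota> \<sigma>"
    and tr: "\<And>x. \<iota> (e x) = x + \<sigma> x"
    and lin: "Vector_Spaces.linear (fscale \<iota>) (*) e"
  shows "norm_trace_pair \<iota> \<sigma> e"
proof -
  obtain \<alpha> \<beta> \<gamma> i j where basis: "quaternion_basis \<iota> \<alpha> \<beta> \<gamma> i j"
    and sig: "\<And>r s t u. \<sigma> (\<iota> r + \<iota> s * i + \<iota> t * j + \<iota> u * (i * j)) =
        \<iota> r + \<iota> s * (\<iota> \<beta> - i) - \<iota> t * j - \<iota> u * (i * j)"
    using conj unfolding quaternionic_conjugation_def by blast
  have ii: "i * i = \<iota> \<alpha> + \<iota> \<beta> * i" and jj: "j * j = \<iota> \<gamma>" and ji: "j * i = (\<iota> \<beta> - i) * j"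
    and ex: "\<exists>!(r, s, t, u). x = \<iota> r + \<iota> s * i + \<iota> t * j + \<iota> u * (i * j)" for x
    using basis unfolding quaternion_basis_def by blast+
  let ?q = "quaternion i j"
  note qm = quaternion_mult[OF ii jj ji]
  have q: "?q r s t u = \<iota> r + \<iota> s * i + \<iota> t * j + \<iota> u * (i * j)" for r s t u
    by (simp add: quaternion_def algebra_simps)
  have coords: "\<exists>r s t u. x = ?q r s t u" for x
    using ex1_implies_ex[OF ex[of x]] by (auto simp: q)
  have sq: "\<sigma> (?q r s t u) = ?q (r + \<beta> * s) (- s) (- t) (- u)" for r s t u
    unfolding q sig by (simp add: embed_add embed_mult embed_minus embed_ac algebra_simps)
  have inv_add: "\<sigma> (x + y) = \<sigma> x + \<sigma> y" for x y
  proof -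
    have qa: "?q r s t u + ?q r' s' t' u' = ?q (r + r') (s + s') (t + t') (u + u')"
      for r s t u r' s' t' u'
      by (simp add: quaternion_def embed_add algebra_simps)
    show ?thesis
      using coords[of x] coords[of y] by (auto simp: qa sq algebra_simps)
  qed
  have inv_mult: "\<sigma> (x * y) = \<sigma> y * \<sigma> x" for x y
    using coords[of x] coords[of y]
    by (elim exE, hypsubst, unfold qm sq)
      (rule arg_cong4[where f = ?q]; simp add: algebra_simps)
  have invol: "\<sigma> (\<sigma> x) = x" for x
    using coords[of x] by (auto simp: sq)
  show ?thesis
  proof unfold_locales
    fix w
    obtain r s t u where w: "w = ?q r s t u" using coords by blast
    have "\<exists>N. w * \<sigma> w = ?q N 0 0 0"
      unfolding w sq qm by (rule exI, rule arg_cong4[where f = ?q], rule refl)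
        (simp_all add: algebra_simps)
    then obtain N where N: "w * \<sigma> w = \<iota> N" by (auto simp: quaternion_def)
    have "e (w * s * \<sigma> w) = N * e s" for s
    proof -
      have "\<iota> (e (w * s * \<sigma> w)) = w * (s + \<sigma> s) * \<sigma> w"
        by (simp add: tr inv_mult invol algebra_simps)
      also have "\<dots> = \<iota> (e s) * (w * \<sigma> w)"
        by (metis tr embed_central mult.assoc)
      also have "\<dots> = \<iota> (N * e s)" by (simp add: N embed_mult[symmetric] mult.commute)
      finally show ?thesis by (simp add: embed_eq_iff)
    qed
    then show "\<exists>N. w * \<sigma> w = \<iota> N \<and> (\<forall>s. e (w * s * \<sigma> w) = N * e s)" using N by auto
  next
    fix x
    have "\<iota> (e (\<sigma> x)) = \<iota> (e x)" by (simp add: tr invol add.commute)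
    then show "e (\<sigma> x) = e x" by (simp add: embed_eq_iff)
  qed (simp_all add: linear_form_rules[OF lin] inv_add inv_mult invol)
qed

lemma norm_trace_pair_of_associated_pair:
  assumes type: "quadratic_type \<iota>" and pair: "associated_pair \<iota> \<sigma> e"
  shows "norm_trace_pair \<iota> \<sigma> e"
proof -
  have std: "standard_involution \<iota> \<sigma>" and lin: "Vector_Spaces.linear (fscale \<iota>) (*) e"
    using pair by (auto simp: associated_pair_def)
  consider "quadratic_type1 \<iota>" | "quadratic_type2 \<iota>" | "quadratic_type3 \<iota>" | "quadratic_type4 \<iota>"
    using type by (auto simp: quadratic_type_def)
  then show ?thesis
  proof cases
    case 1
    have surj: "x \<in> range \<iota>" for x
      using 1 by (intro degree_one_surj) (simp add: quadratic_type1_def)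
    have "norm_trace_pair \<iota> id e"
    proof (rule norm_trace_pair_id[OF _ surj lin])
      show "x * y = y * x" for x y :: 'd using surj[of x] embed_central by auto
    qed
    then show ?thesis using 1 std by (simp add: standard_involution_def)
  next
    case 2
    then show ?thesis
      using std pair lin
      by (intro norm_trace_pair_separable)
        (auto simp: quadratic_type2_def separable_field_extension_def commutative_ring_def
          standard_involution_def associated_pair_def)
  next
    case 3
    then show ?thesis
      using std pair lin
      by (intro norm_trace_pair_quaternion) (auto simp: standard_involution_def associated_pair_def)
  next
    case 4
    then have "norm_trace_pair \<iota> id e"
      using lin
      by (intro norm_trace_pair_id)
        (auto simp: quadratic_type4_def commutative_ring_def power2_eq_square)
    then show ?thesis using 4 std by (simp add: standard_involution_def)
  qed
qed

end

section \<open>The orthogonal hyperplanes\<close>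

lemma (in right_vector_space) rscale_diff: "(x - y) \<cdot> a = x \<cdot> a - y \<cdot> a"
  using add_rscale[of "x - y" y a] by (simp add: algebra_simps)

lemma (in right_vector_space) zero_rscale: "0 \<cdot> a = 0"
  using add_rscale[of 0 0 a] by simp

lemma (in right_vector_space) rscale_zero: "x \<cdot> 0 = 0"
  using rscale_add[of x 0 0] by simp

lemma (in right_vector_space) exists_nonzero:
  assumes "has_right_dimension (\<cdot>) n" and "n > 0"
  shows "\<exists>x::'v. x \<noteq> 0"
proof (rule ccontr)
  assume "\<not> ?thesis"
  then have zero: "x = 0" for x :: 'v by simp
  obtain S where S: "right_basis (\<cdot>) S" "card S = n"
    using assms(1) unfolding has_right_dimension_def by blast
  then obtain s where "s \<in> S" using assms(2) by fastforce
  moreover have "(\<Sum>s\<in>S. s \<cdot> 1) = 0" by (rule zero)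
  then have "\<forall>s\<in>S. (1 :: 'd) = 0"
    using S(1) unfolding right_basis_def by (elim conjE allE[of _ "\<lambda>_. 1"] impE)
  ultimately show False by simp
qed

locale nonisotropic_form =
  norm_trace_pair \<iota> \<sigma> e + right_vector_space rs
  for \<iota> :: "'f::field \<Rightarrow> 'd::division_ring" and \<sigma> e
    and rs :: "'v::ab_group_add \<Rightarrow> 'd \<Rightarrow> 'v" (infixl \<open>\<cdot>\<close> 75) +
  fixes B :: "'v \<Rightarrow> 'v \<Rightarrow> 'd"
  assumes sesq: "sesquilinear (\<cdot>) \<sigma> B" and noniso: "nonisotropic e B"
begin

abbreviation b :: "'v \<Rightarrow> 'v \<Rightarrow> 'f" where
  "b x y \<equiv> e (B x y)"

lemma form_zero_right [simp]: "B z 0 = 0"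
proof -
  have "B z (0 \<cdot> 1 + 0) = B z 0 * 1 + B z 0" using sesq unfolding sesquilinear_def by blast
  then show ?thesis by (simp add: zero_rscale)
qed

lemma form_zero_left [simp]: "B 0 z = 0"
proof -
  have "B (0 \<cdot> 1 + 0) z = \<sigma> 1 * B 0 z + B 0 z"
    using sesq unfolding sesquilinear_def by blast
  then have "\<sigma> 1 * B 0 z = 0" by (simp add: zero_rscale)
  then show ?thesis by simp
qed

lemma form_add_right: "B z (x + y) = B z x + B z y"
proof -
  have "B z (x \<cdot> 1 + y) = B z x * 1 + B z y" using sesq unfolding sesquilinear_def by blast
  then show ?thesis by (simp add: rscale_one)
qed

lemma form_scale_right: "B z (x \<cdot> a) = B z x * a"
proof -
  have "B z (x \<cdot> a + 0) = B z x * a + B z 0" using sesq unfolding sesquilinear_def by blast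
  then show ?thesis by simp
qed

lemma form_scale_left: "B (x \<cdot> a) z = \<sigma> a * B x z"
proof -
  have "B (x \<cdot> a + 0) z = \<sigma> a * B x z + B 0 z" using sesq unfolding sesquilinear_def by blast
  then show ?thesis by simp
qed

lemma form_add_left: "B (x + y) z = B x z + B y z"
proof -
  have "\<sigma> 1 = 1" by (metis inv_mult inv_inv mult.left_neutral)
  moreover have "B (x \<cdot> 1 + y) z = \<sigma> 1 * B x z + B y z"
    using sesq unfolding sesquilinear_def by blast
  ultimately show ?thesis by (simp add: rscale_one)
qed

lemma form_diff_right: "B z (x - y) = B z x - B z y"
  using form_add_right[of z "x - y" y] by (simp add: algebra_simps)

lemma exists_alternating_endo_scaled_self:
  assumes "x \<noteq> 0" and "b x (x \<cdot> t) = 0"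
  shows "\<exists>u\<in>alternating_endos (\<cdot>) b. u x = x \<cdot> t"
proof -
  define s where "s = t * inverse (\<sigma> (B x x))"
  define u where "u z = x \<cdot> (s * \<sigma> (B z x))" for z
  have ne: "B x x \<noteq> 0" using noniso assms(1) unfolding nonisotropic_def by force
  then have t: "t = s * \<sigma> (B x x)" by (simp add: s_def mult.assoc)
  have "e (B x x * s * \<sigma> (B x x)) = 0"
    using assms(2) by (simp add: form_scale_right t mult.assoc)
  then have "e s = 0" using e_norm_eq_zero_iff[OF ne] by blast
  then have "e (w * s * \<sigma> w) = 0" for w using e_norm_eq_zero_iff[of w s] by (cases "w = 0") auto
  then have "u \<in> alternating_endos (\<cdot>) b"
    by (auto simp: alternating_endos_def End_right_def u_def form_add_left inv_add distrib_left
      rscale_add form_scale_left inv_mult form_scale_right rscale_mult[symmetric] mult.assoc)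
  moreover have "u x = x \<cdot> t" by (simp add: u_def t)
  ultimately show ?thesis by blast
qed

lemma alternating_endo_skew:
  "(\<lambda>z. y \<cdot> \<sigma> (B z x) - x \<cdot> \<sigma> (B z y)) \<in> alternating_endos (\<cdot>) b"
proof -
  have "e (B z y * \<sigma> (B z x) - B z x * \<sigma> (B z y)) = 0" for z
    using e_inv[of "B z y * \<sigma> (B z x)"] by (simp add: e_diff inv_mult)
  then show ?thesis
    by (auto simp: alternating_endos_def End_right_def form_add_left inv_add rscale_add
      form_scale_left inv_mult form_scale_right form_diff_right rscale_diff rscale_mult)
qed

lemma alternating_endos_add:
  assumes "u \<in> alternating_endos (\<cdot>) b" and "v \<in> alternating_endos (\<cdot>) b"
  shows "(\<lambda>z. u z + v z) \<in> alternating_endos (\<cdot>) b"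
  using assms
  by (auto simp: alternating_endos_def End_right_def add_rscale form_add_right e_add algebra_simps)

lemma exists_alternating_endo:
  assumes "x \<noteq> 0" and "b x y = 0"
  shows "\<exists>u\<in>alternating_endos (\<cdot>) b. u x = y"
proof -
  define y' where "y' = y \<cdot> inverse (\<sigma> (B x x))"
  define t where "t = \<sigma> (B x y')"
  define u where "u z = y' \<cdot> \<sigma> (B z x) - x \<cdot> \<sigma> (B z y')" for z
  have u: "u \<in> alternating_endos (\<cdot>) b" unfolding u_def by (rule alternating_endo_skew)
  have "B x x \<noteq> 0" using noniso assms(1) unfolding nonisotropic_def by force
  then have ux: "u x = y - x \<cdot> t"
    by (simp add: u_def t_def y'_def rscale_mult[symmetric] rscale_one)
  have "b x (u x) = 0" using u by (simp add: alternating_endos_def)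
  then have "b x (x \<cdot> t) = 0" using assms(2) by (simp add: ux form_diff_right e_diff)
  then obtain v where v: "v \<in> alternating_endos (\<cdot>) b" "v x = x \<cdot> t"
    using exists_alternating_endo_scaled_self[OF assms(1)] by blast
  show ?thesis
    using alternating_endos_add[OF u v(1)] ux v(2)
    by (intro bexI[of _ "\<lambda>z. u z + v z"]) simp_all
qed

lemma form_eq_zero:
  fixes x :: 'v
  assumes "x \<noteq> 0" and "\<And>a. e (w * a) = 0"
  shows "w = 0"
proof (rule ccontr)
  assume "w \<noteq> 0"
  then have "e (B x x) = 0" using assms(2)[of "inverse w * B x x"] by (simp add: mult.assoc[symmetric])
  then show False using noniso assms(1) unfolding nonisotropic_def by blast
qed

lemma proportional_if_alternating_subset:
  assumes B': "sesquilinear (\<cdot>) \<sigma> B'" "nonisotropic e B'"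
    and sub: "alternating_endos (\<cdot>) b \<subseteq> alternating_endos (\<cdot>) (\<lambda>x y. e (B' x y))"
    and nontriv: "\<exists>x::'v. x \<noteq> 0"
  shows "\<exists>\<alpha>. \<alpha> \<noteq> 0 \<and> (\<forall>x y. B' x y = \<iota> \<alpha> * B x y)"
proof -
  interpret B': nonisotropic_form \<iota> \<sigma> e "(\<cdot>)" B'
    using B' by unfold_locales
  define l where "l x = B'.b x x / b x x" for x
  have bxx: "b x x \<noteq> 0" if "x \<noteq> 0" for x using noniso that unfolding nonisotropic_def by blast
  have e_scale_right: "e (w * \<iota> a) = a * e w" for w a
    by (metis e_scale embed_central)
  have b'_eq: "B'.b x y = l x * b x y" for x y
  proof (cases "x = 0")
    case False
    define c where "c = b x y / b x x"
    have "b x (y - x \<cdot> \<iota> c) = 0"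
      using bxx[OF False] by (simp add: form_diff_right form_scale_right e_diff e_scale_right c_def)
    then obtain u where u: "u \<in> alternating_endos (\<cdot>) b" "u x = y - x \<cdot> \<iota> c"
      using exists_alternating_endo[OF False] by blast
    have "u \<in> alternating_endos (\<cdot>) B'.b" using u(1) sub by (rule subsetD[rotated])
    then have "B'.b x (u x) = 0" unfolding alternating_endos_def by blast
    then have "B'.b x (y - x \<cdot> \<iota> c) = 0" unfolding u(2) .
    then show ?thesis
      by (simp add: B'.form_diff_right B'.form_scale_right e_diff e_scale_right c_def l_def)
  qed simp
  have l_const: "l x = l y" if x: "x \<noteq> 0" and y: "y \<noteq> 0" for x y
  proof (cases "l (x + y) = l y")
    case xy: True
    have "B'.b (x + y) x = B'.b x x + B'.b y x" by (simp add: B'.form_add_left e_add)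
    then have "l y * (b x x + b y x) = l x * b x x + l y * b y x"
      by (simp add: b'_eq form_add_left e_add xy)
    then show ?thesis using bxx[OF x] by (simp add: algebra_simps)
  next
    case xy: False
    txt \<open>Comparing \<open>b' (x + y, z)\<close> with \<open>b' (x, z) + b' (y, z)\<close> shows that a combination
      \<open>x p + y q\<close> is orthogonal to every \<open>z\<close>, hence vanishes; then \<open>y\<close> is a multiple of \<open>x\<close>.\<close>
    define p where "p = l (x + y) - l x"
    define q where "q = l (x + y) - l y"
    have inv_embed: "e (\<sigma> (\<iota> a) * w) = a * e w" for a w
    proof -
      have "e (\<sigma> (\<iota> a) * w) = e (\<sigma> w * \<iota> a)" using e_inv[of "\<sigma> w * \<iota> a"] by (simp add: inv_mult)
      then show ?thesis by (simp add: e_scale_right e_inv)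
    qed
    have orth: "b (x \<cdot> \<iota> p + y \<cdot> \<iota> q) z = 0" for z
    proof -
      have "B'.b (x + y) z = B'.b x z + B'.b y z" by (simp add: B'.form_add_left e_add)
      then have "l (x + y) * (b x z + b y z) = l x * b x z + l y * b y z"
        by (simp add: b'_eq form_add_left e_add)
      then show ?thesis
        by (simp add: form_add_left form_scale_left e_add inv_embed p_def q_def algebra_simps)
    qed
    then have "x \<cdot> \<iota> p + y \<cdot> \<iota> q = 0" using bxx by blast
    then have "(x \<cdot> \<iota> p + y \<cdot> \<iota> q) \<cdot> \<iota> (inverse q) = 0" by (simp add: zero_rscale)
    moreover have "\<iota> q * \<iota> (inverse q) = 1"
      using xy by (simp add: q_def embed_mult[symmetric] embed_one)
    ultimately have "x \<cdot> \<iota> (p * inverse q) + y = 0"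
      by (simp add: add_rscale rscale_mult[symmetric] embed_mult rscale_one)
    then have "y = - (x \<cdot> \<iota> (p * inverse q))" by (simp add: eq_neg_iff_add_eq_0 add.commute)
    also have "\<dots> = x \<cdot> \<iota> (- (p * inverse q))"
      using rscale_add[of x "\<iota> (p * inverse q)" "- \<iota> (p * inverse q)"]
      by (simp add: embed_minus rscale_zero neg_eq_iff_add_eq_0)
    finally obtain c where c: "y = x \<cdot> \<iota> c" by blast
    have "c \<noteq> 0" using y c by (auto simp: rscale_zero)
    have "B'.b y x = c * B'.b x x" "b y x = c * b x x"
      by (simp_all add: c B'.form_scale_left form_scale_left inv_embed)
    then have "l y * (c * b x x) = c * (l x * b x x)" by (simp add: b'_eq)
    then show ?thesis using \<open>c \<noteq> 0\<close> bxx[OF x] by simp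
  qed
  obtain x0 :: 'v where x0: "x0 \<noteq> 0" using nontriv by blast
  have "B' x y = \<iota> (l x0) * B x y" for x y
  proof -
    have b'_eq0: "B'.b x y = l x0 * b x y" for y
      using b'_eq[of x y] l_const[OF _ x0, of x] by (cases "x = 0") auto
    have "e ((B' x y - \<iota> (l x0) * B x y) * a) = 0" for a
      using b'_eq0[of "y \<cdot> a"]
      by (simp add: B'.form_scale_right form_scale_right left_diff_distrib e_diff e_scale mult.assoc)
    then have "B' x y - \<iota> (l x0) * B x y = 0" by (rule form_eq_zero[OF x0])
    then show ?thesis by simp
  qed
  moreover have "l x0 \<noteq> 0"
    using x0 bxx B'(2) unfolding l_def nonisotropic_def by simp
  ultimately show ?thesis by blast
qed

end

section \<open>Similarity and equivalence\<close>

lemma inverse_in_End_right: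
  assumes "u \<in> End_right rs" and "bij u"
  shows "inv u \<in> End_right rs"
proof -
  have surj: "u (inv u x) = x" for x using assms(2) by (simp add: bij_is_surj surj_f_inv_f)
  have inj: "u x = u y \<Longrightarrow> x = y" for x y using assms(2) by (meson bij_is_inj injD)
  have lin: "u (x + y) = u x + u y" "u (rs x c) = rs (u x) c" for x y c
    using assms(1) by (auto simp: End_right_def)
  have "inv u (x + y) = inv u x + inv u y" "inv u (rs x c) = rs (inv u x) c" for x y c
    by (rule inj, simp add: lin surj)+
  then show ?thesis by (simp add: End_right_def)
qed

lemma End_right_comp:
  "u \<in> End_right rs \<Longrightarrow> v \<in> End_right rs \<Longrightarrow> u \<circ> v \<in> End_right rs"
  by (simp add: End_right_def)

theorem theorem1p13:
  fixes \<iota> :: "'f::field \<Rightarrow> 'd::division_ring"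
    and d n :: nat
    and rs :: "'v::ab_group_add \<Rightarrow> 'd \<Rightarrow> 'v"
    and \<sigma> :: "'d \<Rightarrow> 'd"
    and e :: "'d \<Rightarrow> 'f"
    and B B' :: "'v \<Rightarrow> 'v \<Rightarrow> 'd"
    and b b' :: "'v \<Rightarrow> 'v \<Rightarrow> 'f"
  assumes "central_subfield \<iota>"
    and "has_degree \<iota> d"
    and "right_vector_space rs"
    and "has_right_dimension rs n"
    and "n > 0"
    and "quadratic_type \<iota>"
    and "associated_pair \<iota> \<sigma> e"
    and "sesquilinear rs \<sigma> B" and "nonisotropic e B"
    and "sesquilinear rs \<sigma> B'" and "nonisotropic e B'"
    and "b = (\<lambda>x y. e (B x y))"
    and "b' = (\<lambda>x y. e (B' x y))"
  shows "similar_in_End rs (alternating_endos rs b) (alternating_endos rs b') \<longleftrightarrow>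
         (\<exists>\<alpha>::'f. \<alpha> \<noteq> 0 \<and> equivalent_forms rs B' (\<lambda>x y. \<iota> \<alpha> * B x y))"
proof -
  note assms_b = assms(12,13)
  interpret central_subfield \<iota> by fact
  interpret norm_trace_pair \<iota> \<sigma> e
    by (rule norm_trace_pair_of_associated_pair) fact+
  interpret nonisotropic_form \<iota> \<sigma> e rs B
    using assms(3,8,9) by (simp add: nonisotropic_form_def nonisotropic_form_axioms_def norm_trace_pair_axioms)
  show ?thesis
  proof
    assume "similar_in_End rs (alternating_endos rs b) (alternating_endos rs b')"
    then obtain a a' where a: "a \<in> End_right rs" and a': "a' \<in> End_right rs"
      and aa': "a \<circ> a' = id" and a'a: "a' \<circ> a = id"
      and eq: "alternating_endos rs b' = (\<lambda>u. a \<circ> u \<circ> a') ` alternating_endos rs b"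
      unfolding similar_in_End_def by blast
    have cancel: "a (a' x) = x" "a' (a x) = x" for x
      using aa' a'a by (simp_all add: fun_eq_iff)
    let ?C = "\<lambda>x y. B' (a x) (a y)"
    have "sesquilinear rs \<sigma> ?C"
      using assms(10) a by (simp add: sesquilinear_def End_right_def)
    moreover have "nonisotropic e ?C"
      unfolding nonisotropic_def
    proof (intro allI impI)
      fix x :: 'v
      assume "x \<noteq> 0"
      then have "a x \<noteq> 0" using a cancel unfolding End_right_def
        by (metis (mono_tags, lifting) add_cancel_right_right mem_Collect_eq)
      then show "e (?C x x) \<noteq> 0" using assms(11) by (simp add: nonisotropic_def)
    qed
    moreover have "alternating_endos rs b \<subseteq> alternating_endos rs (\<lambda>x y. e (?C x y))"
    proof
      fix u
      assume u: "u \<in> alternating_endos rs b"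
      then have "a \<circ> u \<circ> a' \<in> alternating_endos rs b'" using eq by blast
      then have "e (B' (a x) ((a \<circ> u \<circ> a') (a x))) = 0" for x
        by (simp add: alternating_endos_def assms_b)
      then show "u \<in> alternating_endos rs (\<lambda>x y. e (?C x y))"
        using u by (simp add: alternating_endos_def cancel)
    qed
    moreover have "\<exists>x::'v. x \<noteq> 0"
      using exists_nonzero assms(4,5) by blast
    ultimately obtain \<alpha> where \<alpha>: "\<alpha> \<noteq> 0" "\<And>x y. ?C x y = \<iota> \<alpha> * B x y"
      using proportional_if_alternating_subset[of ?C] unfolding assms_b by blast
    have "\<iota> \<alpha> * B (a' x) (a' y) = B' x y" for x y
      using \<alpha>(2)[of "a' x" "a' y"] by (simp add: cancel)
    moreover have "bij a'" using aa' a'a by (rule o_bij)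
    ultimately show "\<exists>\<alpha>. \<alpha> \<noteq> 0 \<and> equivalent_forms rs B' (\<lambda>x y. \<iota> \<alpha> * B x y)"
      using a' \<alpha>(1) unfolding equivalent_forms_def by blast
  next
    assume "\<exists>\<alpha>. \<alpha> \<noteq> 0 \<and> equivalent_forms rs B' (\<lambda>x y. \<iota> \<alpha> * B x y)"
    then obtain \<alpha> \<phi> where \<alpha>: "\<alpha> \<noteq> 0" and \<phi>: "\<phi> \<in> End_right rs" "bij \<phi>"
      and eq: "\<And>x y. \<iota> \<alpha> * B (\<phi> x) (\<phi> y) = B' x y"
      unfolding equivalent_forms_def by blast
    let ?\<psi> = "inv \<phi>"
    have \<psi>: "?\<psi> \<in> End_right rs" by (rule inverse_in_End_right[OF \<phi>])
    have cancel: "?\<psi> (\<phi> x) = x" "\<phi> (?\<psi> x) = x" for x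
      using \<phi>(2) by (simp_all add: bij_is_inj bij_is_surj surj_f_inv_f)
    have b': "b' x y = \<alpha> * b (\<phi> x) (\<phi> y)" for x y
      by (simp add: assms_b eq[symmetric] e_scale)
    have "alternating_endos rs b' = (\<lambda>u. ?\<psi> \<circ> u \<circ> \<phi>) ` alternating_endos rs b"
    proof (intro equalityI subsetI)
      fix u
      assume u: "u \<in> alternating_endos rs b'"
      have "\<phi> \<circ> u \<circ> ?\<psi> \<in> alternating_endos rs b"
        unfolding alternating_endos_def
      proof (intro CollectI conjI allI)
        show "\<phi> \<circ> u \<circ> ?\<psi> \<in> End_right rs"
          using u \<phi> \<psi> by (simp add: alternating_endos_def End_right_comp)
        fix x
        have "b' (?\<psi> x) (u (?\<psi> x)) = 0" using u by (simp add: alternating_endos_def)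
        then show "b x ((\<phi> \<circ> u \<circ> ?\<psi>) x) = 0" using \<alpha> by (simp add: b' cancel)
      qed
      moreover have "u = ?\<psi> \<circ> (\<phi> \<circ> u \<circ> ?\<psi>) \<circ> \<phi>" by (simp add: fun_eq_iff cancel)
      ultimately show "u \<in> (\<lambda>u. ?\<psi> \<circ> u \<circ> \<phi>) ` alternating_endos rs b" by blast
    next
      fix v
      assume "v \<in> (\<lambda>u. ?\<psi> \<circ> u \<circ> \<phi>) ` alternating_endos rs b"
      then obtain u where u: "u \<in> alternating_endos rs b" and v: "v = ?\<psi> \<circ> u \<circ> \<phi>" by blast
      then show "v \<in> alternating_endos rs b'"
        using \<phi> \<psi> by (simp add: alternating_endos_def End_right_comp b' cancel)
    qed
    moreover have "?\<psi> \<circ> \<phi> = id" "\<phi> \<circ> ?\<psi> = id" by (simp_all add: fun_eq_iff cancel)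
    ultimately show "similar_in_End rs (alternating_endos rs b) (alternating_endos rs b')"
      using \<phi>(1) \<psi> unfolding similar_in_End_def by blast
  qed
qed

end
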